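(* Let $\mathcal{L}_+ = \dfrac{\Gamma(\frac13)\,\Gamma(\frac56)}{\Gamma(\frac16)}$ be the conjectural value of Landau's constant, and let $\mathsf{ag}_3$ denote the cubic arithmetic-geometric mean. Then $$\mathsf{ag}_3(\sqrt[3]{2},1) = 2\mathcal{L}_+ .$$
   Context: $\Gamma$ is Euler's Gamma function. Cubic arithmetic-geometric mean: for reals $a_0>b_0>0$, $\mathsf{ag}_3(a_0,b_0)$ is the common limit of the sequences defined by $a_{n+1}=\frac{a_n+2b_n}{3}$ and $b_{n+1}=\sqrt[3]{b_n\,\frac{a_n^2+a_nb_n+b_n^2}{3}}$ (real cube root). *)

theory Defs
  imports "HOL-Analysis.Analysis"
begin

fun ag3_a ag3_b :: "real \<Rightarrow> real \<Rightarrow> nat \<Rightarrow> real" where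
  "ag3_a a0 b0 0 = a0"
| "ag3_b a0 b0 0 = b0"
| "ag3_a a0 b0 (Suc n) = (ag3_a a0 b0 n + 2 * ag3_b a0 b0 n) / 3"
| "ag3_b a0 b0 (Suc n) = root 3 (ag3_b a0 b0 n *
     (((ag3_a a0 b0 n)\<^sup>2 + ag3_a a0 b0 n * ag3_b a0 b0 n + (ag3_b a0 b0 n)\<^sup>2) / 3))"

(* Meaningful for a0 > b0 > 0, where the limit exists by ag3_common_limit below;
   outside that range the value of the description operator may be unspecified. *)
definition ag3 :: "real \<Rightarrow> real \<Rightarrow> real" where
  "ag3 a0 b0 = (THE L. ag3_a a0 b0 \<longlonglongrightarrow> L \<and> ag3_b a0 b0 \<longlonglongrightarrow> L)"

definition landau_plus :: real where
  "landau_plus = Gamma (1/3) * Gamma (5/6) / Gamma (1/6)"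

lemma ag3_step:
  fixes a b :: real
  assumes "0 < b" "b \<le> a"
  defines "b' \<equiv> root 3 (b * ((a\<^sup>2 + a * b + b\<^sup>2) / 3))"
  shows "b \<le> b'" "b' \<le> (a + 2 * b) / 3"
proof -
  have "b ^ 3 \<le> b * ((a\<^sup>2 + a * b + b\<^sup>2) / 3)"
  proof -
    have "b * b \<le> a * b" "a * b \<le> a * a"
      using assms(1,2) by (auto intro: mult_mono)
    then have "b\<^sup>2 \<le> (a\<^sup>2 + a * b + b\<^sup>2) / 3"
      unfolding power2_eq_square by argo
    then have "b * b\<^sup>2 \<le> b * ((a\<^sup>2 + a * b + b\<^sup>2) / 3)"
      using assms(1) by (intro mult_left_mono) auto
    then show ?thesis by (simp add: power3_eq_cube power2_eq_square)
  qed
  then have "root 3 (b ^ 3) \<le> b'"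
    unfolding b'_def by (intro real_root_le_mono) auto
  then show "b \<le> b'"
    using assms by (simp add: real_root_power_cancel)
  have "((a + 2 * b) / 3) ^ 3 - b * ((a\<^sup>2 + a * b + b\<^sup>2) / 3) = ((a - b) / 3) ^ 3"
    by (simp add: power3_eq_cube power2_eq_square field_simps)
  moreover have "0 \<le> ((a - b) / 3) ^ 3"
    using assms by (intro zero_le_power) auto
  ultimately have "b * ((a\<^sup>2 + a * b + b\<^sup>2) / 3) \<le> ((a + 2 * b) / 3) ^ 3"
    by linarith
  then have "b' \<le> root 3 (((a + 2 * b) / 3) ^ 3)"
    unfolding b'_def by (intro real_root_le_mono) auto
  then show "b' \<le> (a + 2 * b) / 3"
    using assms by (simp add: real_root_power_cancel)
qed

lemma ag3_common_limit:
  assumes "0 < b0" "b0 < a0"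
  shows "ag3_a a0 b0 \<longlonglongrightarrow> ag3 a0 b0" "ag3_b a0 b0 \<longlonglongrightarrow> ag3 a0 b0"
proof -
  let ?a = "ag3_a a0 b0" and ?b = "ag3_b a0 b0"
  have inv: "b0 \<le> ?b n \<and> ?b n \<le> ?a n \<and> ?a n \<le> a0 \<and> ?a n - ?b n \<le> (a0 - b0) * (1/3) ^ n" for n
  proof (induction n)
    case 0
    then show ?case using assms by simp
  next
    case (Suc n)
    then have "?b n \<le> ?b (Suc n)" "?b (Suc n) \<le> ?a (Suc n)"
      using ag3_step[of "?b n" "?a n"] assms by auto
    moreover define e where "e = (a0 - b0) * (1/3) ^ n"
    moreover have "?a (Suc n) = (?a n + 2 * ?b n) / 3" "(a0 - b0) * (1/3) ^ Suc n = e / 3"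
      by (simp_all add: e_def)
    ultimately show ?case
      using Suc unfolding e_def[symmetric] by (intro conjI; argo)
  qed
  have "?b n \<le> ?b (Suc n)" for n
    using ag3_step(1)[of "?b n" "?a n"] inv[of n] assms by simp
  then have "incseq ?b" by (rule incseq_SucI)
  moreover have "?b n \<le> a0" for n
    using inv[of n] by linarith
  ultimately obtain L where L: "?b \<longlonglongrightarrow> L"
    using incseq_convergent by metis
  have gap: "(\<lambda>n. (a0 - b0) * (1/3) ^ n) \<longlonglongrightarrow> 0"
    by (intro tendsto_mult_right_zero LIMSEQ_realpow_zero) auto
  have "(\<lambda>n. ?a n - ?b n) \<longlonglongrightarrow> 0"
    by (rule tendsto_sandwich[OF _ _ tendsto_const gap]) (use inv in auto)
  from tendsto_add[OF this L] have "?a \<longlonglongrightarrow> L" by simp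
  with L have "ag3 a0 b0 = L"
    unfolding ag3_def by (intro the_equality) (auto intro: LIMSEQ_unique)
  with L \<open>?a \<longlonglongrightarrow> L\<close> show "?a \<longlonglongrightarrow> ag3 a0 b0" "?b \<longlonglongrightarrow> ag3 a0 b0"
    by simp_all
qed

end

(* With F(z) = 2F1(1/3, 2/3; 1; z), the quantity F(1 - (b/a)^3) / a is unchanged by one step of the
   cubic mean, which is Ramanujan's cubic transformation
     F(1 - ((1-x)/(1+2x))^3) = (1+2x) F(x^3)   at   x = (a-b)/(a+2b).
   Passing to the limit gives ag3(a,b) = a / F(1 - (b/a)^3).  The transformation holds because both of
   its sides solve (p y')' = q y with p = x(1-x^3)/(1+2x)^2 and q = 2(1-x)^2/(1+2x)^4; as p vanishes at
   0 and both sides are regular there, their Wronskian vanishes, so their ratio is constant.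
   For (a,b) = (2^(1/3), 1) the argument is 1/2, where Euler's integral becomes a Beta integral. *)
theory Submission imports Defs begin

section \<open>The hypergeometric series 2F1(1/3, 2/3; 1; z) for |z| < 1\<close>

definition cubic_coeff :: "nat \<Rightarrow> real" where
  "cubic_coeff n = pochhammer (1/3) n * pochhammer (2/3) n / (fact n)\<^sup>2"

definition cubic_F :: "real \<Rightarrow> real" where
  "cubic_F z = (\<Sum>n. cubic_coeff n * z ^ n)"

definition cubic_F' :: "real \<Rightarrow> real" where
  "cubic_F' z = (\<Sum>n. diffs cubic_coeff n * z ^ n)"

lemma cubic_coeff_0 [simp]: "cubic_coeff 0 = 1"
  by (simp add: cubic_coeff_def)

lemma cubic_coeff_Suc:
  "(real n + 1)\<^sup>2 * cubic_coeff (Suc n) = (real n + 1/3) * (real n + 2/3) * cubic_coeff n"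
  by (simp add: cubic_coeff_def pochhammer_Suc power2_eq_square divide_simps del: of_nat_Suc)
     (simp add: algebra_simps)

lemma cubic_coeff_nonneg: "0 \<le> cubic_coeff n"
  by (simp add: cubic_coeff_def pochhammer_nonneg)

text \<open>By \<open>cubic_coeff_Suc\<close> each coefficient is the previous one times (n + 1/3)(n
  + 2/3) / (n + 1)^2, a factor below 1. The bound lets a geometric series dominate the power
  series.\<close>

lemma cubic_coeff_le_1: "cubic_coeff n \<le> 1"
proof (induction n)
  case (Suc n)
  have "(real n + 1/3) * (real n + 2/3) * cubic_coeff n \<le> (real n + 1)\<^sup>2 * 1"
    using Suc cubic_coeff_nonneg
    by (intro mult_mono) (auto simp: power2_eq_square intro!: mult_mono)
  then have "(real n + 1)\<^sup>2 * cubic_coeff (Suc n) \<le> (real n + 1)\<^sup>2 * 1"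
    by (simp only: cubic_coeff_Suc)
  then show ?case
    by (rule mult_left_le_imp_le) simp
qed simp

lemma summable_cubic_coeff:
  assumes "\<bar>z\<bar> < 1"
  shows "summable (\<lambda>n. cubic_coeff n * z ^ n)"
proof (rule summable_comparison_test')
  show "summable (\<lambda>n. \<bar>z\<bar> ^ n)"
    using assms by (simp add: summable_geometric)
  show "norm (cubic_coeff n * z ^ n) \<le> \<bar>z\<bar> ^ n" if "n \<ge> 0" for n
    using cubic_coeff_le_1[of n] cubic_coeff_nonneg[of n]
    by (simp add: abs_mult power_abs mult_left_le_one_le)
qed

lemma DERIV_cubic_F:
  assumes "\<bar>z\<bar> < 1"
  shows "(cubic_F has_real_derivative cubic_F' z) (at z)"
  unfolding cubic_F_def[abs_def] cubic_F'_def
  by (rule termdiffs_strong'[where K = 1]) (use assms in \<open>auto intro: summable_cubic_coeff\<close>)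

lemma cubic_F_0 [simp]: "cubic_F 0 = 1"
  using powser_zero[of cubic_coeff] by (simp add: cubic_F_def)

text \<open>All terms are nonnegative, so the constant term bounds the sum from below. This later
  makes the divisor \<open>H\<close> positive.\<close>

lemma cubic_F_ge_1:
  assumes "0 \<le> z" "z < 1"
  shows "1 \<le> cubic_F z"
proof -
  have "(\<Sum>n\<in>{0}. cubic_coeff n * z ^ n) \<le> cubic_F z"
    unfolding cubic_F_def
    by (rule sum_le_suminf) (use assms cubic_coeff_nonneg in \<open>auto intro!: summable_cubic_coeff\<close>)
  then show ?thesis by simp
qed

text \<open>The hypergeometric equation in self-adjoint form, \<open>(z (1 - z) F')' = 2/9 F\<close>, so that no second
  derivative of \<open>F\<close> is needed.\<close>

definition cubic_flux :: "real \<Rightarrow> real" where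
  "cubic_flux z = z * (1 - z) * cubic_F' z"

text \<open>The coefficient recurrence collapses the product, since (n + 1/3)(n + 2/3) - n (n + 1) =
  2/9. At index 0 the division by \<open>real 0\<close> gives \<open>w 0 = 0\<close>, which matches
  the absent constant term.\<close>

lemma cubic_flux_powser:
  assumes "\<bar>z\<bar> < 1"
  defines "w \<equiv> \<lambda>n. 2/9 * cubic_coeff (n - 1) / real n"
  shows "summable (\<lambda>n. w n * z ^ n)" "cubic_flux z = (\<Sum>n. w n * z ^ n)"
proof -
  have d: "(\<lambda>n. diffs cubic_coeff n * z ^ n) sums cubic_F' z"
    unfolding cubic_F'_def
    by (rule summable_sums, rule termdiff_converges[where K = 1])
       (use assms in \<open>auto intro: summable_cubic_coeff\<close>)
  have "(\<lambda>n. real n * cubic_coeff n * z ^ n) sums (z * cubic_F' z)"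
  proof -
    have "(\<lambda>n. real (Suc n) * cubic_coeff (Suc n) * z ^ Suc n) sums (z * cubic_F' z)"
      using sums_mult[OF d, of z] by (simp add: diffs_def mult_ac)
    then show ?thesis
      by (subst (asm) sums_Suc_iff) simp
  qed
  from sums_mult[OF sums_diff[OF d this], of z]
  have "(\<lambda>n. z * (diffs cubic_coeff n * z ^ n - real n * cubic_coeff n * z ^ n))
          sums (z * (cubic_F' z - z * cubic_F' z))" .
  moreover have "z * (diffs cubic_coeff n * z ^ n - real n * cubic_coeff n * z ^ n)
      = w (Suc n) * z ^ Suc n" for n
  proof -
    have "(real n + 1) * (diffs cubic_coeff n - real n * cubic_coeff n) = 2/9 * cubic_coeff n"
      using cubic_coeff_Suc[of n] by (simp add: diffs_def algebra_simps power2_eq_square)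
    then have "diffs cubic_coeff n - real n * cubic_coeff n = w (Suc n)"
      by (simp add: w_def field_simps)
    then show ?thesis by (simp add: algebra_simps flip: right_diff_distrib left_diff_distrib)
  qed
  moreover have "z * (cubic_F' z - z * cubic_F' z) = cubic_flux z"
    by (simp add: cubic_flux_def algebra_simps)
  ultimately have "(\<lambda>n. w (Suc n) * z ^ Suc n) sums cubic_flux z"
    by simp
  then have "(\<lambda>n. w n * z ^ n) sums cubic_flux z"
    by (subst (asm) sums_Suc_iff) (simp add: w_def)
  then show "summable (\<lambda>n. w n * z ^ n)" "cubic_flux z = (\<Sum>n. w n * z ^ n)"
    by (simp_all add: sums_iff)
qed

text \<open>Termwise differentiation cancels the 1/n in the flux series and leaves 2/9 times the
  series of F.\<close>

lemma DERIV_cubic_flux: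
  assumes "\<bar>z\<bar> < 1"
  shows "(cubic_flux has_real_derivative 2/9 * cubic_F z) (at z)"
proof -
  define w where "w = (\<lambda>n. 2/9 * cubic_coeff (n - 1) / real n)"
  have "((\<lambda>z. \<Sum>n. w n * z ^ n) has_real_derivative (\<Sum>n. diffs w n * z ^ n)) (at z)"
    by (rule termdiffs_strong'[where K = 1])
       (use assms cubic_flux_powser in \<open>auto simp: w_def\<close>)
  moreover have "diffs w n * z ^ n = 2/9 * (cubic_coeff n * z ^ n)" for n
    by (simp add: diffs_def w_def del: of_nat_Suc)
  then have "(\<Sum>n. diffs w n * z ^ n) = 2/9 * cubic_F z"
    using assms by (simp only: cubic_F_def suminf_mult summable_cubic_coeff)
  moreover have "(\<Sum>n. w n * y ^ n) = cubic_flux y" if "y \<in> ball 0 1" for y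
    using cubic_flux_powser(2)[of y] that by (simp add: w_def)
  ultimately show ?thesis
    using assms
    by (auto elim!: has_field_derivative_transform_within_open[where S = "ball 0 1"])
qed

section \<open>Ramanujan's cubic transformation\<close>

lemma cubic_F_transformation:
  assumes "0 \<le> x" "x < 1"
  shows "cubic_F (1 - ((1 - x) / (1 + 2 * x)) ^ 3) = (1 + 2 * x) * cubic_F (x ^ 3)"
proof (cases "x = 0")
  case False
  define u where "u = (\<lambda>t::real. 1 - ((1 - t) / (1 + 2 * t)) ^ 3)"
  define u' where "u' = (\<lambda>t::real. 9 * (1 - t)\<^sup>2 / (1 + 2 * t) ^ 4)"
  \<comment> \<open>Pulling (z (1 - z) F')' = 2/9 F back along z = u(t) gives (p y')' = q y with p
    u' = u (1 - u) and q = 2/9 u'.\<close>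
  define p where "p = (\<lambda>t::real. t * (1 - t ^ 3) / (1 + 2 * t)\<^sup>2)"
  define q where "q = (\<lambda>t::real. 2 * (1 - t)\<^sup>2 / (1 + 2 * t) ^ 4)"
  define H where "H = (\<lambda>t. (1 + 2 * t) * cubic_F (t ^ 3))"
  define H' where "H' = (\<lambda>t. 2 * cubic_F (t ^ 3) + (1 + 2 * t) * (cubic_F' (t ^ 3) * (3 * t\<^sup>2)))"
  define G where "G = (\<lambda>t. cubic_F (u t))"
  define G' where "G' = (\<lambda>t. cubic_F' (u t) * u' t)"
  have u_bound: "0 \<le> u t" "u t < 1" if "0 \<le> t" "t < 1" for t
  proof -
    have "0 < ((1 - t) / (1 + 2 * t)) ^ 3" "((1 - t) / (1 + 2 * t)) ^ 3 \<le> 1"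
      using that by (auto intro!: power_le_one simp: divide_simps)
    then show "0 \<le> u t" "u t < 1"
      by (simp_all add: u_def)
  qed
  have cube_bound: "0 \<le> t ^ 3" "t ^ 3 < 1" if "0 \<le> t" "t < 1" for t :: real
    using that by (auto simp: power_less_one_iff)
  have Du: "(u has_real_derivative u' t) (at t)" if "0 \<le> t" for t
  proof -
    have nz: "1 + 2 * t \<noteq> 0" using that by linarith
    then have D: "((\<lambda>t. (1 - t) / (1 + 2 * t)) has_real_derivative - 3 / (1 + 2 * t)\<^sup>2) (at t)"
      by (auto intro!: derivative_eq_intros simp: power2_eq_square)
    have "(u has_real_derivative
        - (3 * ((1 - t) / (1 + 2 * t))\<^sup>2 * (- 3 / (1 + 2 * t)\<^sup>2))) (at t)"
      unfolding u_def using DERIV_diff[OF DERIV_const DERIV_power[OF D, of 3], of 1]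
      by (simp add: mult_ac)
    also have "- (3 * ((1 - t) / (1 + 2 * t))\<^sup>2 * (- 3 / (1 + 2 * t)\<^sup>2)) = u' t"
      by (simp add: u'_def power_divide flip: power_add)
    finally show ?thesis .
  qed
  have DG: "(G has_real_derivative G' t) (at t)" if "0 \<le> t" "t < 1" for t
    unfolding G_def G'_def
    by (rule DERIV_chain'[OF Du DERIV_cubic_F, unfolded mult.commute[of "u' t"]]) (use that u_bound[of t] in auto)
  have Dcube: "((\<lambda>t::real. t ^ 3) has_real_derivative 3 * t\<^sup>2) (at t)" for t
    by (auto intro!: derivative_eq_intros)
  have DF3: "((\<lambda>t. cubic_F (t ^ 3)) has_real_derivative cubic_F' (t ^ 3) * (3 * t\<^sup>2)) (at t)"
    if "0 \<le> t" "t < 1" for t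
    by (rule DERIV_chain2[OF DERIV_cubic_F Dcube]) (use that cube_bound[of t] in auto)
  have DH: "(H has_real_derivative H' t) (at t)" if "0 \<le> t" "t < 1" for t
    unfolding H_def H'_def by (auto intro!: derivative_eq_intros DF3 that)
  have pG': "p t * G' t = cubic_flux (u t)" if "0 \<le> t" "t < 1" for t
  proof -
    have nz: "1 + 2 * t \<noteq> 0" using that by linarith
    have "p t * u' t = u t * (1 - u t)"
      unfolding p_def u_def u'_def using nz
      by (simp add: divide_simps) (simp add: algebra_simps power2_eq_square power3_eq_cube power4_eq_xxxx)
    then show ?thesis
      by (simp add: G'_def cubic_flux_def mult_ac)
  qed
  have DpG': "((\<lambda>t. cubic_flux (u t)) has_real_derivative q t * G t) (at t)" if "0 \<le> t" "t < 1" for t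
  proof -
    have "((\<lambda>t. cubic_flux (u t)) has_real_derivative 2/9 * cubic_F (u t) * u' t) (at t)"
      by (rule DERIV_chain2[OF DERIV_cubic_flux Du]) (use that u_bound[of t] in auto)
    also have "2/9 * cubic_F (u t) * u' t = q t * G t"
      by (simp add: u'_def q_def G_def)
    finally show ?thesis .
  qed
  \<comment> \<open>\<open>V\<close> is \<open>p H'\<close>, with \<open>F'\<close> only inside the flux, whose derivative is known.\<close>
  define V where "V = (\<lambda>t. 2 * p t * cubic_F (t ^ 3) + 3 * cubic_flux (t ^ 3) / (1 + 2 * t))"
  have pH': "p t * H' t = V t" if "0 \<le> t" for t
  proof -
    have nz: "1 + 2 * t \<noteq> 0" using that by linarith
    then show ?thesis
      unfolding H'_def V_def p_def cubic_flux_def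
      by (simp add: divide_simps) (simp add: algebra_simps power2_eq_square power3_eq_cube)
  qed
  \<comment> \<open>Thus (p H')' = q H, the equation that \<open>DpG'\<close> gives for
    \<open>G\<close>. The terms with F' cancel (\<open>F'_terms\<close>), and the coefficient of F
    comes down to a polynomial identity (\<open>F_terms\<close>).\<close>
  have DV: "(V has_real_derivative q t * H t) (at t)" if t: "0 \<le> t" "t < 1" for t
  proof -
    have nz: "1 + 2 * t \<noteq> 0" using that by linarith
    define p' where "p' = (1 - 4 * t ^ 3) / (1 + 2 * t)\<^sup>2 - 4 * (t * (1 - t ^ 3)) / (1 + 2 * t) ^ 3"
    have Dp: "(p has_real_derivative p') (at t)"
    proof -
      have *: "(A * e\<^sup>2 - B * (4 * e)) / (e\<^sup>2 * e\<^sup>2) = A / e\<^sup>2 - 4 * B / e ^ 3"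
        if "e \<noteq> 0" for A B e :: real
        using that by (simp add: field_simps power2_eq_square power3_eq_cube)
      have "((\<lambda>t. t * (1 - t ^ 3)) has_real_derivative 1 - 4 * t ^ 3) (at t)"
        by (auto intro!: derivative_eq_intros simp: algebra_simps power3_eq_cube power2_eq_square)
      moreover have "((\<lambda>t. (1 + 2 * t)\<^sup>2) has_real_derivative 4 * (1 + 2 * t)) (at t)"
        by (auto intro!: derivative_eq_intros)
      ultimately have "(p has_real_derivative ((1 - 4 * t ^ 3) * (1 + 2 * t)\<^sup>2 -
          t * (1 - t ^ 3) * (4 * (1 + 2 * t))) / ((1 + 2 * t)\<^sup>2 * (1 + 2 * t)\<^sup>2)) (at t)"
        unfolding p_def using nz
        by (intro DERIV_divide) simp_all
      also have "((1 - 4 * t ^ 3) * (1 + 2 * t)\<^sup>2 - t * (1 - t ^ 3) * (4 * (1 + 2 * t))) /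
          ((1 + 2 * t)\<^sup>2 * (1 + 2 * t)\<^sup>2) = p'"
        unfolding p'_def by (rule *[OF nz])
      finally show ?thesis .
    qed
    have Dflux: "((\<lambda>t. cubic_flux (t ^ 3)) has_real_derivative
        2/9 * cubic_F (t ^ 3) * (3 * t\<^sup>2)) (at t)"
      by (rule DERIV_chain2[OF DERIV_cubic_flux Dcube]) (use that cube_bound[of t] in auto)
    have "((\<lambda>t. 3 * cubic_flux (t ^ 3) / (1 + 2 * t)) has_real_derivative
        (3 * (2/9 * cubic_F (t ^ 3) * (3 * t\<^sup>2)) * (1 + 2 * t) - 3 * cubic_flux (t ^ 3) * 2) /
          ((1 + 2 * t) * (1 + 2 * t))) (at t)"
      using nz by (intro DERIV_divide DERIV_cmult Dflux) (auto intro!: derivative_eq_intros)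
    also have "(3 * (2/9 * cubic_F (t ^ 3) * (3 * t\<^sup>2)) * (1 + 2 * t) - 3 * cubic_flux (t ^ 3) * 2) /
          ((1 + 2 * t) * (1 + 2 * t)) =
        2 * t\<^sup>2 * cubic_F (t ^ 3) / (1 + 2 * t) - 6 * cubic_flux (t ^ 3) / (1 + 2 * t)\<^sup>2"
      using nz by (simp add: diff_divide_distrib power2_eq_square)
    finally have Dquot: "((\<lambda>t. 3 * cubic_flux (t ^ 3) / (1 + 2 * t)) has_real_derivative
        2 * t\<^sup>2 * cubic_F (t ^ 3) / (1 + 2 * t) - 6 * cubic_flux (t ^ 3) / (1 + 2 * t)\<^sup>2) (at t)" .
    have D: "(V has_real_derivative
        2 * p' * cubic_F (t ^ 3) + 2 * p t * (cubic_F' (t ^ 3) * (3 * t\<^sup>2))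
        + (2 * t\<^sup>2 * cubic_F (t ^ 3) / (1 + 2 * t) - 6 * cubic_flux (t ^ 3) / (1 + 2 * t)\<^sup>2)) (at t)"
      unfolding V_def
      by (intro DERIV_add Dquot)
         (use DERIV_mult[OF DERIV_cmult[OF Dp, of 2] DF3[OF t]] in \<open>simp add: mult_ac add_ac\<close>)
    have F'_terms: "2 * p t * (cubic_F' (t ^ 3) * (3 * t\<^sup>2)) = 6 * cubic_flux (t ^ 3) / (1 + 2 * t)\<^sup>2"
      by (simp add: p_def cubic_flux_def power2_eq_square power3_eq_cube)
    have F_terms: "2 * p' + 2 * t\<^sup>2 / (1 + 2 * t) = q t * (1 + 2 * t)"
    proof -
      \<comment> \<open>With e = 1 + 2 t kept opaque, clearing denominators leaves only the
        polynomial identity that follows.\<close>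
      have *: "2 * (A / e\<^sup>2 - 4 * B / e ^ 3) + 2 * C / e = 2 * (A * e - 4 * B + C * e\<^sup>2) / e ^ 4 * e"
        if "e \<noteq> 0" for A B C e :: real
        using that by (simp add: field_simps power2_eq_square power3_eq_cube power4_eq_xxxx)
      have "(1 - 4 * t ^ 3) * (1 + 2 * t) - 4 * (t * (1 - t ^ 3)) + t\<^sup>2 * (1 + 2 * t)\<^sup>2 = (1 - t)\<^sup>2"
        by (simp add: algebra_simps power2_eq_square power3_eq_cube)
      then show ?thesis
        unfolding p'_def q_def *[OF nz] by simp
    qed
    have "2 * p' * cubic_F (t ^ 3) + 2 * p t * (cubic_F' (t ^ 3) * (3 * t\<^sup>2))
        + (2 * t\<^sup>2 * cubic_F (t ^ 3) / (1 + 2 * t) - 6 * cubic_flux (t ^ 3) / (1 + 2 * t)\<^sup>2)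
        = (2 * p' + 2 * t\<^sup>2 / (1 + 2 * t)) * cubic_F (t ^ 3)"
      unfolding F'_terms by (simp add: algebra_simps)
    also have "\<dots> = q t * H t"
      unfolding F_terms by (simp add: H_def)
    finally show ?thesis using D by simp
  qed
  have wronskian: "G' t * H t = G t * H' t" if t: "0 < t" "t < 1" for t
  proof -
    \<comment> \<open>\<open>N\<close> is p times the Wronskian G' H - G H', with p G' and p H'
      expressed by the flux and \<open>V\<close>, so that it can be differentiated without
      F''.\<close>
    define N where "N = (\<lambda>t. cubic_flux (u t) * H t - G t * V t)"
    have DN: "(N has_real_derivative 0) (at s)" if s: "0 \<le> s" "s < 1" for s
    proof -
      have "(N has_real_derivative (q s * G s * H s + H' s * cubic_flux (u s)) -
              (G' s * V s + q s * H s * G s)) (at s)"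
        unfolding N_def by (intro DERIV_diff DERIV_mult DpG' DH DG DV s)
      \<comment> \<open>Both sides are p G' H'; the two q G H terms cancel as well.\<close>
      moreover have "H' s * cubic_flux (u s) = G' s * V s"
        using pG'[OF s] pH'[OF s(1)] by (metis mult.assoc mult.commute)
      ultimately show ?thesis by (simp add: algebra_simps)
    qed
    have "N t = N 0"
    proof (rule DERIV_isconst_end[where f = N])
      show "continuous_on {0..t} N"
        using t by (intro continuous_at_imp_continuous_on ballI DERIV_isCont[OF DN]) auto
    qed (use t DN in auto)
    \<comment> \<open>At the singular point 0 the flux and \<open>V\<close> both vanish.\<close>
    also have "N 0 = 0"
      by (simp add: N_def V_def p_def u_def cubic_flux_def)
    finally have "p t * G' t * H t - G t * (p t * H' t) = 0"
      using pG'[of t] pH'[of t] t by (simp add: N_def)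
    then have "p t * (G' t * H t - G t * H' t) = 0"
      by (simp add: algebra_simps)
    moreover have "p t \<noteq> 0"
      using t cube_bound[of t] by (simp add: p_def)
    ultimately show ?thesis by simp
  qed
  have H_pos: "0 < H t" if "0 \<le> t" "t < 1" for t
    using cubic_F_ge_1[OF cube_bound[OF that]] that by (simp add: H_def)
  \<comment> \<open>The derivative is shown to vanish only on the open interval, where p was nonzero
    and could be cancelled from the Wronskian; continuity includes the endpoint 0. The interval must
    be nondegenerate, hence the separate case x = 0.\<close>
  have "G x / H x = G 0 / H 0"
  proof (rule DERIV_isconst_end[where f = "\<lambda>t. G t / H t"])
    have "isCont (\<lambda>t. G t / H t) t" if "0 \<le> t" "t \<le> x" for t
      using that assms H_pos[of t]
      by (intro continuous_intros DERIV_isCont[OF DG] DERIV_isCont[OF DH]) auto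
    then show "continuous_on {0..x} (\<lambda>t. G t / H t)"
      by (intro continuous_at_imp_continuous_on) auto
    show "((\<lambda>t. G t / H t) has_real_derivative 0) (at t)" if t: "0 < t" "t < x" for t
    proof -
      have "((\<lambda>t. G t / H t) has_real_derivative (G' t * H t - G t * H' t) / (H t * H t)) (at t)"
        using t assms H_pos[of t] by (intro DERIV_divide DG DH) auto
      then show ?thesis using wronskian[of t] t assms by simp
    qed
  qed (use False assms in simp)
  also have "\<dots> = 1"
    by (simp add: G_def H_def u_def)
  finally show ?thesis
    using H_pos[of x] assms by (simp add: G_def H_def u_def)
qed simp

section \<open>Invariance under the cubic mean iteration and passage to the limit\<close>

lemma ag3_bounds:
  assumes "0 < b" "b \<le> a"
  shows "0 < ag3_b a b n \<and> ag3_b a b n \<le> ag3_a a b n"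
proof (induction n)
  case (Suc n)
  then show ?case
    using ag3_step[of "ag3_b a b n" "ag3_a a b n"] by (simp del: real_root_gt_0_iff)
qed (use assms in simp)

text \<open>For the x chosen in the proof, (1 - x) / (1 + 2 x) = b / a and 1 + 2 x = a / a', so the
  cubic transformation at x yields the claim after division by a.\<close>

lemma cubic_F_ag3_step:
  assumes "0 < b" "b \<le> a"
  defines "a' \<equiv> (a + 2 * b) / 3" and "b' \<equiv> root 3 (b * ((a\<^sup>2 + a * b + b\<^sup>2) / 3))"
  shows "cubic_F (1 - (b / a) ^ 3) / a = cubic_F (1 - (b' / a') ^ 3) / a'"
proof -
  define x where "x = (a - b) / (a + 2 * b)"
  have pos: "a > 0" "a + 2 * b > 0" using assms by auto
  have "0 \<le> x" "x < 1"
    using assms pos by (auto simp: x_def divide_simps)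
  from cubic_F_transformation[OF this]
  have "cubic_F (1 - ((1 - x) / (1 + 2 * x)) ^ 3) = (1 + 2 * x) * cubic_F (x ^ 3)" .
  moreover have x1: "1 + 2 * x = a / a'"
    using pos by (simp add: x_def a'_def field_simps)
  moreover have "1 - x = b / a'"
    using pos by (simp add: x_def a'_def field_simps)
  then have "(1 - x) / (1 + 2 * x) = b / a"
    using pos x1 by (simp add: a'_def)
  \<comment> \<open>This rests on a'^3 - b'^3 = ((a - b) / 3)^3, together with x = ((a - b) / 3) /
    a'.\<close>
  moreover have "x ^ 3 = 1 - (b' / a') ^ 3"
  proof -
    have "b' ^ 3 = b * ((a\<^sup>2 + a * b + b\<^sup>2) / 3)"
      using odd_real_root_pow[of 3] by (simp add: b'_def)
    then show ?thesis
      using pos unfolding x_def a'_def power_divide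
      by (simp add: divide_simps) (simp add: algebra_simps power2_eq_square power3_eq_cube)
  qed
  ultimately show ?thesis using pos by simp
qed

text \<open>The invariant is constant along the iteration. The ratio of the two sequences tends to 1
  and F is continuous at 0 with F(0) = 1, so the constant equals 1 / \<open>ag3 a b\<close>.\<close>

theorem ag3_eq_cubic_F:
  assumes "0 < b" "b < a"
  shows "ag3 a b = a / cubic_F (1 - (b / a) ^ 3)"
proof -
  let ?a = "ag3_a a b" and ?b = "ag3_b a b"
  have const: "cubic_F (1 - (?b n / ?a n) ^ 3) / ?a n = cubic_F (1 - (b / a) ^ 3) / a" for n
  proof (induction n)
    case (Suc n)
    then show ?case
      using cubic_F_ag3_step[of "?b n" "?a n"] ag3_bounds[of b a n] assms by simp
  qed simp
  note lim = ag3_common_limit[OF assms]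
  \<comment> \<open>This lower bound keeps the common limit away from 0, so that the ratio converges
    to 1.\<close>
  have "?b n \<ge> b" for n
  proof (induction n)
    case (Suc n)
    then show ?case
      using ag3_step(1)[of "?b n" "?a n"] ag3_bounds[of b a n] assms by simp
  qed simp
  then have L: "ag3 a b > 0"
    using LIMSEQ_le_const[OF lim(2), of b] assms by force
  have "(\<lambda>n. cubic_F (1 - (?b n / ?a n) ^ 3) / ?a n) \<longlonglongrightarrow>
          cubic_F (1 - (ag3 a b / ag3 a b) ^ 3) / ag3 a b"
    using L by (intro tendsto_intros lim isCont_tendsto_compose[OF DERIV_isCont[OF DERIV_cubic_F]]) auto
  then have "cubic_F (1 - (b / a) ^ 3) / a = 1 / ag3 a b"
    unfolding const using L by (simp add: LIMSEQ_const_iff)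
  then show ?thesis
    using L assms by (metis divide_divide_eq_right mult_1 nonzero_divide_eq_eq divide_eq_0_iff times_divide_eq_left)
qed

section \<open>Evaluation of F(1/2) by Euler's integral\<close>

text \<open>This is Newton's binomial series at -y with exponent -a; the sign in the generalized
  binomial coefficient cancels that of (-y)^n.\<close>

lemma pochhammer_powser_sums:
  fixes a y :: real
  assumes "\<bar>y\<bar> < 1"
  shows "(\<lambda>n. pochhammer a n / fact n * y ^ n) sums (1 - y) powr (- a)"
proof -
  have "(\<lambda>n. ((- a) gchoose n) * (- y) ^ n) sums (1 + (- y)) powr (- a)"
    by (rule gen_binomial_real) (use assms in simp)
  moreover have "((- a) gchoose n) * (- y) ^ n = pochhammer a n / fact n * y ^ n" for n
  proof -
    have "(- 1) ^ n * (- y) ^ n = y ^ n"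
      by (simp flip: power_mult_distrib)
    then show ?thesis by (simp add: gbinomial_pochhammer)
  qed
  ultimately show ?thesis by simp
qed

text \<open>The extended nonnegative form allows sum and integral to be exchanged later by
  nonnegativity and measurability alone.\<close>

lemma nn_integral_Beta:
  fixes a b :: real
  assumes "a > 0" "b > 0"
  shows "(\<integral>\<^sup>+t. ennreal (t powr (a - 1) * (1 - t) powr (b - 1)) * indicator {0..1} t \<partial>lborel) =
    ennreal (Beta a b)"
  by (rule nn_integral_has_integral_lebesgue'[OF _ has_integral_Beta_real[OF assms]]) auto

text \<open>The arguments 1/3 and n + 2/3 add up to n + 1, so the denominator of the Beta value is
  n!, while Gamma(n + 2/3) supplies the second Pochhammer factor.\<close>

lemma Beta_cubic_coeff:
  "Beta (1/3) (real n + 2/3) * (pochhammer (1/3) n / fact n) =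
     Gamma (1/3) * Gamma (2/3) * cubic_coeff n"
proof -
  have "Gamma (real n + 2/3) = pochhammer (2/3) n * Gamma (2/3)"
    using pochhammer_rGamma[of "2/3 :: real" n] Gamma_real_pos[of "2/3"] Gamma_real_pos[of "real n + 2/3"]
    by (simp add: rGamma_inverse_Gamma add.commute divide_simps del: Gamma_real_pos)
  moreover have "Gamma (1 + real n) = fact n"
    by (rule Gamma_fact)
  ultimately show ?thesis
    by (simp add: Beta_def cubic_coeff_def power2_eq_square add_ac)
qed

text \<open>Euler's integral for the hypergeometric function, with \<open>w = 1 - t\<close> in place of the usual
  variable: then \<open>1 - t/2 = (1 + w)/2\<close>, and the substitution \<open>v = w\<^sup>2\<close> turns it into a Beta integral.\<close>

lemma cubic_F_half:
  "Gamma (1/3) * Gamma (2/3) * cubic_F (1/2) = 2 powr (1/3) / 2 * Beta (1/6) (2/3)"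
proof -
  define C where "C = Gamma (1/3) * Gamma (2/3 :: real)"
  have C: "C > 0" by (simp add: C_def)
  \<comment> \<open>\<open>f n\<close> is the n-th term of Euler's integrand after binomial
    expansion of (1 - (1 - w)/2)^(-1/3). The factor (1 - w)^n is absorbed into the power, so that
    each term is a multiple of a Beta integrand.\<close>
  define f where "f = (\<lambda>n w::real. pochhammer (1/3) n / fact n * (1/2) ^ n *
    (w powr (1/3 - 1) * (1 - w) powr (real n + 2/3 - 1)))"
  have f_nonneg: "0 \<le> f n w" for n w
    by (simp add: f_def pochhammer_nonneg)
  have f_sums: "(\<lambda>n. f n w) sums (2 powr (1/3) * (w powr (-2/3) * (1 - w\<^sup>2) powr (-1/3)))"
    if w: "0 \<le> w" "w \<le> 1" for w
  \<comment> \<open>At w = 1 all terms and the sum are 0 because \<open>0 powr r = 0\<close>;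
    merging the powers of 1 - w requires 1 - w > 0.\<close>
  proof (cases "w = 1")
    case False
    have sums: "(\<lambda>n. w powr (-2/3) * (1 - w) powr (-1/3) *
        (pochhammer (1/3) n / fact n * ((1 - w) / 2) ^ n))
        sums (w powr (-2/3) * (1 - w) powr (-1/3) * (1 - (1 - w) / 2) powr (-(1/3)))"
      by (intro sums_mult pochhammer_powser_sums) (use w in auto)
    have summand: "w powr (-2/3) * (1 - w) powr (-1/3) *
        (pochhammer (1/3) n / fact n * ((1 - w) / 2) ^ n) = f n w" for n
    proof -
      have "(1 - w) powr (real n + 2/3 - 1) = (1 - w) powr (real n + -1/3)"
        by (rule arg_cong[where f = "\<lambda>e. (1 - w) powr e"]) simp
      also have "\<dots> = (1 - w) ^ n * (1 - w) powr (-1/3)"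
        using False w by (simp only: powr_add) (simp add: powr_realpow)
      finally show ?thesis
        by (simp add: f_def power_divide)
    qed
    have limit: "w powr (-2/3) * (1 - w) powr (-1/3) * (1 - (1 - w) / 2) powr (-(1/3)) =
        2 powr (1/3) * (w powr (-2/3) * (1 - w\<^sup>2) powr (-1/3))"
    proof -
      have "1 - (1 - w) / 2 = (1 + w) / 2" "1 - w\<^sup>2 = (1 - w) * (1 + w)"
        by (simp_all add: field_simps power2_eq_square)
      then show ?thesis
        using w by (simp only:) (simp add: powr_mult powr_divide powr_minus divide_simps)
    qed
    show ?thesis using sums by (simp only: summand limit)
  qed (simp add: f_def)
  have [measurable]: "f n \<in> borel_measurable borel" for n
    unfolding f_def by measurable
  have "ennreal (C * cubic_F (1/2)) = (\<Sum>n. ennreal (C * (cubic_coeff n * (1/2) ^ n)))"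
    using C cubic_coeff_nonneg summable_cubic_coeff[of "1/2"]
    by (simp add: cubic_F_def suminf_mult summable_mult suminf_ennreal2)
  also have "\<dots> = (\<Sum>n. \<integral>\<^sup>+w. ennreal (f n w) * indicator {0..1} w \<partial>lborel)"
  proof (rule suminf_cong)
    fix n
    have coeff_nonneg: "0 \<le> pochhammer (1/3 :: real) n / fact n * (1/2) ^ n"
      by (simp add: pochhammer_nonneg)
    have "(\<integral>\<^sup>+w. ennreal (f n w) * indicator {0..1} w \<partial>lborel) =
      (\<integral>\<^sup>+w. ennreal (pochhammer (1/3) n / fact n * (1/2) ^ n) *
        (ennreal (w powr (1/3 - 1) * (1 - w) powr (real n + 2/3 - 1)) * indicator {0..1} w) \<partial>lborel)"
      unfolding f_def by (simp only: ennreal_mult'[OF coeff_nonneg] mult.assoc[where 'a = ennreal])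
    also have "\<dots> = ennreal (pochhammer (1/3) n / fact n * (1/2) ^ n) * ennreal (Beta (1/3) (real n + 2/3))"
      by (subst nn_integral_cmult, measurable, subst nn_integral_Beta) simp_all
    also have "\<dots> = ennreal ((1/2) ^ n * (Beta (1/3) (real n + 2/3) * (pochhammer (1/3) n / fact n)))"
      by (subst ennreal_mult[symmetric])
         (auto simp: pochhammer_nonneg mult_ac Beta_def intro!: divide_nonneg_nonneg mult_nonneg_nonneg)
    finally show "ennreal (C * (cubic_coeff n * (1/2) ^ n)) =
        (\<integral>\<^sup>+w. ennreal (f n w) * indicator {0..1} w \<partial>lborel)"
      unfolding Beta_cubic_coeff C_def by (simp add: mult_ac)
  qed
  \<comment> \<open>Nonnegative measurable terms permit the exchange of sum and integral.\<close>
  also have "\<dots> = (\<integral>\<^sup>+w. (\<Sum>n. ennreal (f n w) * indicator {0..1} w) \<partial>lborel)"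
    by (rule nn_integral_suminf[symmetric]) measurable
  \<comment> \<open>The summed integrand becomes a function of w^2 times the derivative 2 w, ready
    for v = w^2; the exponents agree since 2 (1/6 - 1) + 1 = -2/3.\<close>
  also have "\<dots> = (\<integral>\<^sup>+w. ennreal (2 powr (1/3) / 2) *
      (ennreal ((w\<^sup>2) powr (1/6 - 1) * (1 - w\<^sup>2) powr (2/3 - 1) * (2 * w)) * indicator {0..1} w) \<partial>lborel)"
  proof (rule nn_integral_cong)
    fix w :: real
    have "(w\<^sup>2) powr (1/6 - 1) * w = w powr (-2/3)" if "w \<ge> 0"
    proof (cases "w = 0")
      case False
      with that have "w > 0" by simp
      then have "w\<^sup>2 = w powr 2"
        by simp
      then have "(w\<^sup>2) powr (1/6 - 1) * w = w powr (2 * (1/6 - 1)) * w powr 1"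
        by (simp only: powr_powr) (use \<open>w > 0\<close> in simp)
      also have "\<dots> = w powr (-2/3)"
        by (subst powr_add[symmetric]) simp
      finally show ?thesis .
    qed simp
    then have *: "2 powr (1/3) / 2 * ((w\<^sup>2) powr (1/6 - 1) * (1 - w\<^sup>2) powr (2/3 - 1) * (2 * w)) =
        2 powr (1/3) * (w powr (-2/3) * (1 - w\<^sup>2) powr (-1/3))" if "w \<ge> 0"
      using that by (simp add: mult_ac)
    show "(\<Sum>n. ennreal (f n w) * indicator {0..1} w) = ennreal (2 powr (1/3) / 2) *
      (ennreal ((w\<^sup>2) powr (1/6 - 1) * (1 - w\<^sup>2) powr (2/3 - 1) * (2 * w)) * indicator {0..1} w)"
    proof (cases "w \<in> {0..1}")
      case True
      then have w_nonneg: "0 \<le> w" by simp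
      from True have "(\<Sum>n. ennreal (f n w)) = ennreal (2 powr (1/3) * (w powr (-2/3) * (1 - w\<^sup>2) powr (-1/3)))"
        by (intro suminf_ennreal_eq f_nonneg f_sums) auto
      also have "\<dots> = ennreal (2 powr (1/3) / 2) *
          ennreal ((w\<^sup>2) powr (1/6 - 1) * (1 - w\<^sup>2) powr (2/3 - 1) * (2 * w))"
        by (subst ennreal_mult'[symmetric]) (simp, simp only: *[OF w_nonneg])
      finally show ?thesis using True by simp
    qed simp
  qed
  also have "\<dots> = ennreal (2 powr (1/3) / 2) *
      (\<integral>\<^sup>+w. ennreal ((w\<^sup>2) powr (1/6 - 1) * (1 - w\<^sup>2) powr (2/3 - 1) * (2 * w)) * indicator {0..1} w \<partial>lborel)"
    by (rule nn_integral_cmult) measurable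
  also have "(\<integral>\<^sup>+w. ennreal ((w\<^sup>2) powr (1/6 - 1) * (1 - w\<^sup>2) powr (2/3 - 1) * (2 * w)) * indicator {0..1} w \<partial>lborel)
      = (\<integral>\<^sup>+v. ennreal (v powr (1/6 - 1) * (1 - v) powr (2/3 - 1)) * indicator {0..1} v \<partial>lborel)"
  proof -
    have "(\<integral>\<^sup>+v. ennreal (v powr (1/6 - 1) * (1 - v) powr (2/3 - 1) * indicator {0\<^sup>2..1\<^sup>2} v) \<partial>lborel) =
      (\<integral>\<^sup>+w. ennreal ((w\<^sup>2) powr (1/6 - 1) * (1 - w\<^sup>2) powr (2/3 - 1) * (2 * w) * indicator {0..1} w) \<partial>lborel)"
      by (rule nn_integral_substitution[where g = "\<lambda>w::real. w\<^sup>2"])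
         (auto intro!: derivative_eq_intros continuous_intros simp: set_borel_measurable_def)
    then show ?thesis
      by (simp add: ennreal_mult'' ennreal_indicator)
  qed
  also have "\<dots> = ennreal (Beta (1/6) (2/3))"
    by (rule nn_integral_Beta) auto
  also have "ennreal (2 powr (1/3) / 2) * \<dots> = ennreal (2 powr (1/3) / 2 * Beta (1/6) (2/3))"
    by (rule ennreal_mult[symmetric]) (auto simp: Beta_def)
  finally show ?thesis
    unfolding C_def
    by (subst (asm) ennreal_inj)
       (auto simp: Beta_def cubic_F_def intro!: mult_nonneg_nonneg suminf_nonneg summable_cubic_coeff
          simp: cubic_coeff_nonneg)
qed

theorem mainTheorem3:
  shows "ag3 (root 3 2) 1 = 2 * landau_plus"
proof -
  have "1 - (1 / root 3 2) ^ 3 = (1/2 :: real)"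
    by (simp add: power_divide odd_real_root_pow)
  then have "ag3 (root 3 2) 1 = 2 powr (1/3) / cubic_F (1/2)"
    using ag3_eq_cubic_F[of 1 "root 3 2"] by (simp only:) (simp add: root_powr_inverse)
  also have "cubic_F (1/2) = 2 powr (1/3) / 2 * Beta (1/6) (2/3) / (Gamma (1/3) * Gamma (2/3))"
    using cubic_F_half Gamma_real_pos[of "1/3"] Gamma_real_pos[of "2/3"]
    by (simp add: field_simps del: Gamma_real_pos)
  \<comment> \<open>As Beta(1/6, 2/3) = Gamma(1/6) Gamma(2/3) / Gamma(5/6), both Gamma(2/3) and
    2^(1/3) cancel.\<close>
  also have "2 powr (1/3) / \<dots> = 2 * landau_plus"
    using Gamma_real_pos[of "2/3"] by (simp add: Beta_def landau_plus_def del: Gamma_real_pos)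
  finally show ?thesis .
qed

end
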